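(* Up to equivalence, $K_4^+$ has two orientable 2-cell embeddings and three non-orientable 2-cell embeddings on the double torus.
   Context: $K_4^+$ denotes the multigraph obtained from $K_4$ by doubling one edge. The double torus is the orientable surface of genus 2. A 2-cell embedding is described by a rotation system (for each vertex, a cyclic ordering of its incident edges). Two embeddings are isomorphic if a permutation of vertices and edges (preserving incidence) transforms one rotation system into the other. An embedding and the embedding obtained by reversing all its rotations are considered equivalent. An embedding is non-orientable if its reversal is isomorphic to it, and orientable otherwise. *)

theory Defs
  imports "HOL-Combinatorics.Combinatorics"
begin

text \<open>
  Finite multigraphs without loops: every edge \<open>e\<close> has a two-element set \<open>ends G e\<close> of ends,
  and distinct edges may have the same ends. Without loops, a dart (edge end) is determined by
  its vertex and its edge.
\<close>

record ('v, 'e) multigraph =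
  verts :: "'v set"
  edges :: "'e set"
  ends :: "'e \<Rightarrow> 'v set"

definition incident_edges :: "('v, 'e) multigraph \<Rightarrow> 'v \<Rightarrow> 'e set" where
  "incident_edges G v = {e \<in> edges G. v \<in> ends G e}"

text \<open>
  A rotation system gives for each vertex \<open>v\<close> the permutation sending each edge incident with \<open>v\<close>
  to its successor in the cyclic ordering at \<open>v\<close>. Values that carry no information are normalised
  to the identity, so that equal rotation systems are equal functions. (Vertices are assumed not
  to be isolated, as \<open>cyclic_on f {}\<close> is false.)
\<close>

definition rotation_system :: "('v, 'e) multigraph \<Rightarrow> ('v \<Rightarrow> 'e \<Rightarrow> 'e) \<Rightarrow> bool" where
  "rotation_system G \<pi> \<longleftrightarrow>
     (\<forall>v \<in> verts G. \<pi> v permutes incident_edges G v \<and> cyclic_on (\<pi> v) (incident_edges G v)) \<and>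
     (\<forall>v. v \<notin> verts G \<longrightarrow> \<pi> v = id)"

definition reversal :: "('v \<Rightarrow> 'e \<Rightarrow> 'e) \<Rightarrow> 'v \<Rightarrow> 'e \<Rightarrow> 'e" where
  "reversal \<pi> = (\<lambda>v. inv (\<pi> v))"

definition darts :: "('v, 'e) multigraph \<Rightarrow> ('v \<times> 'e) set" where
  "darts G = {(v, e). v \<in> verts G \<and> e \<in> incident_edges G v}"

definition other_end :: "('v, 'e) multigraph \<Rightarrow> 'v \<Rightarrow> 'e \<Rightarrow> 'v" where
  "other_end G v e = (THE w. ends G e = {v, w})"

text \<open>
  Face tracing: leave \<open>v\<close> along \<open>e\<close>, and at the other end continue along the edge that follows \<open>e\<close>
  in the rotation there. The faces of the embedding are the orbits of this map on the darts.
\<close>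

definition face_step ::
  "('v, 'e) multigraph \<Rightarrow> ('v \<Rightarrow> 'e \<Rightarrow> 'e) \<Rightarrow> 'v \<times> 'e \<Rightarrow> 'v \<times> 'e" where
  "face_step G \<pi> = (\<lambda>(v, e). (other_end G v e, \<pi> (other_end G v e) e))"

definition faces :: "('v, 'e) multigraph \<Rightarrow> ('v \<Rightarrow> 'e \<Rightarrow> 'e) \<Rightarrow> ('v \<times> 'e) set set" where
  "faces G \<pi> = orbit (face_step G \<pi>) ` darts G"

text \<open>
  2-cell embeddings of a connected graph \<open>G\<close> on the orientable surface of genus \<open>g\<close>, as rotation
  systems: gluing a disk along every face gives a closed connected orientable surface, whose genus
  is determined by its Euler characteristic \<open>2 - 2 * g\<close>.
\<close>

definition embeddings :: "('v, 'e) multigraph \<Rightarrow> nat \<Rightarrow> ('v \<Rightarrow> 'e \<Rightarrow> 'e) set" where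
  "embeddings G g = {\<pi>. rotation_system G \<pi> \<and>
     int (card (verts G)) - int (card (edges G)) + int (card (faces G \<pi>)) = 2 - 2 * int g}"

definition isomorphic_embeddings ::
  "('v, 'e) multigraph \<Rightarrow> ('v \<Rightarrow> 'e \<Rightarrow> 'e) \<Rightarrow> ('v \<Rightarrow> 'e \<Rightarrow> 'e) \<Rightarrow> bool" where
  "isomorphic_embeddings G \<pi> \<pi>' \<longleftrightarrow>
     (\<exists>\<alpha> \<beta>. \<alpha> permutes verts G \<and> \<beta> permutes edges G \<and>
        (\<forall>e \<in> edges G. ends G (\<beta> e) = \<alpha> ` ends G e) \<and>
        (\<forall>v \<in> verts G. \<forall>e \<in> incident_edges G v. \<pi>' (\<alpha> v) (\<beta> e) = \<beta> (\<pi> v e)))"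

text \<open>
  Equivalence allows, in addition to isomorphism, the simultaneous reversal of all rotations.
\<close>

definition equivalent_embeddings ::
  "('v, 'e) multigraph \<Rightarrow> ('v \<Rightarrow> 'e \<Rightarrow> 'e) \<Rightarrow> ('v \<Rightarrow> 'e \<Rightarrow> 'e) \<Rightarrow> bool" where
  "equivalent_embeddings G \<pi> \<pi>' \<longleftrightarrow>
     isomorphic_embeddings G \<pi> \<pi>' \<or> isomorphic_embeddings G (reversal \<pi>) \<pi>'"

definition embedding_equiv ::
  "('v, 'e) multigraph \<Rightarrow> nat \<Rightarrow> (('v \<Rightarrow> 'e \<Rightarrow> 'e) \<times> ('v \<Rightarrow> 'e \<Rightarrow> 'e)) set" where
  "embedding_equiv G g =
     {(\<pi>, \<pi>'). \<pi> \<in> embeddings G g \<and> \<pi>' \<in> embeddings G g \<and> equivalent_embeddings G \<pi> \<pi>'}"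

text \<open>
  Orientability here is chirality of the embedding; the surface is always orientable.
\<close>

definition nonorientable_embedding :: "('v, 'e) multigraph \<Rightarrow> ('v \<Rightarrow> 'e \<Rightarrow> 'e) \<Rightarrow> bool" where
  "nonorientable_embedding G \<pi> \<longleftrightarrow> isomorphic_embeddings G (reversal \<pi>) \<pi>"

definition orientable_embedding :: "('v, 'e) multigraph \<Rightarrow> ('v \<Rightarrow> 'e \<Rightarrow> 'e) \<Rightarrow> bool" where
  "orientable_embedding G \<pi> \<longleftrightarrow> \<not> nonorientable_embedding G \<pi>"

text \<open>
  \<open>K\<^sub>4\<close> on the vertices 0, 1, 2, 3 with the edge between 0 and 1 doubled (edges 0 and 1).
\<close>

definition K4_plus :: "(nat, nat) multigraph" where
  "K4_plus = \<lparr> verts = {0, 1, 2, 3}, edges = {..<7},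
     ends = (\<lambda>e. [{0, 1}, {0, 1}, {0, 2}, {0, 3}, {1, 2}, {1, 3}, {2, 3}] ! e) \<rparr>"

end

theory Submission
  imports Defs
begin

text \<open>
  By Euler's formula, the embeddings on the double torus are the rotation systems with a single
  face. There are only 144 rotation systems and 8 automorphisms (a permutation of the vertices
  preserving the parallel pair, possibly followed by exchanging the two parallel edges), so the
  classes can be computed. An injective map of a finite set has a single orbit iff the orbit of
  one point does not close up early, which makes the number of faces easy to check. The rotation
  systems with one face all turn out to be equivalent to one of five pairwise inequivalent
  ones, three of which are isomorphic to their reversals.
\<close>

section \<open>Cycles given by lists\<close>

text \<open>The obstacle is that isomorphism quantifies over functions, and a rotation is a function
  on all naturals, while evaluation needs finite data. So rotations, automorphisms and face tracing
  each get a list version that agrees with the abstract notion where it matters (on incident edges,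
  vertices, darts).

  The outcome has a short explanation. Up to exchanging vertices 0 and 1, isomorphism and reversal
  preserve whether edges 0 and 1 are consecutive or opposite at each end. If the two ends differ, an
  isomorphism from the reversal must fix vertices 0 and 1. It must exchange 2 and 3, since fixing
  vertex 2 would make its three-edge rotation equal to its own reverse. Then the rotation at the
  consecutive end forces edges 0 and 1 to be exchanged, and the rotation at the opposite end forbids
  it. Such embeddings are chiral. The other three representatives have ends of equal type, and an
  automorphism exchanging vertices 0 and 1 as well as edges 0 and 1 carries each reversal
  back.\<close>

fun succ_in :: "'a list \<Rightarrow> 'a \<Rightarrow> 'a \<Rightarrow> 'a" where
  "succ_in [] z x = z"
| "succ_in [y] z x = z"
| "succ_in (y # y' # ys) z x = (if x = y then y' else succ_in (y' # ys) z x)"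

text \<open>A successor lookup that is cheap to evaluate, in contrast to the product of
  transpositions behind \<open>cycle_of_list\<close>. Off the list it returns \<open>hd xs\<close>,
  where \<open>cycle_of_list\<close> fixes the point, so the two agree only on
  \<open>set xs\<close>.\<close>

definition next_in :: "'a list \<Rightarrow> 'a \<Rightarrow> 'a" where
  "next_in xs x = succ_in xs (hd xs) x"

lemma map_succ_in:
  assumes "distinct xs" "xs \<noteq> []"
  shows "map (succ_in xs z) xs = tl xs @ [z]"
  using assms
proof (induction xs rule: induct_list012)
  case (3 y y' ys)
  have "map (succ_in (y # y' # ys) z) (y # y' # ys) = y' # map (succ_in (y # y' # ys) z) (y' # ys)"
    by simp
  also have "map (succ_in (y # y' # ys) z) (y' # ys) = map (succ_in (y' # ys) z) (y' # ys)"
    by (intro map_cong) (use 3(3) in auto)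
  also have "\<dots> = ys @ [z]"
    using 3(2,3) by simp
  finally show ?case
    by simp
qed auto

lemma next_in_eq_cycle_of_list:
  assumes "distinct xs" "x \<in> set xs"
  shows "next_in xs x = cycle_of_list xs x"
proof -
  have "map (next_in xs) xs = rotate1 xs"
    using map_succ_in[of xs "hd xs"] assms unfolding next_in_def[abs_def] by (cases xs) auto
  also have "\<dots> = map (cycle_of_list xs) xs"
    using cyclic_rotation[OF assms(1), of 1] by simp
  finally show ?thesis
    using assms(2) by simp
qed

text \<open>Along the reversed list each entry goes to its predecessor: conjugating
  \<open>rotate1\<close> with \<open>rev\<close> undoes \<open>rotate1\<close>. A right inverse
  suffices, as \<open>cycle_of_list xs\<close> is a bijection.\<close>

lemma inv_cycle_of_list:
  assumes "distinct xs"
  shows "inv (cycle_of_list xs) = cycle_of_list (rev xs)"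
proof -
  have rot: "map (cycle_of_list ys) ys = rotate1 ys" if "distinct ys" for ys :: "'a list"
    using cyclic_rotation[OF that, of 1] by simp
  have "map (cycle_of_list (rev xs)) xs = rev (rotate1 (rev xs))"
    using rot[of "rev xs"] assms by (metis distinct_rev rev_map rev_rev_ident)
  then have "map (cycle_of_list xs \<circ> cycle_of_list (rev xs)) xs
      = rev (rotate1 (rev (map (cycle_of_list xs) xs)))"
    by (metis list.map_comp rev_map rotate1_map)
  also have "\<dots> = xs"
    unfolding rot[OF assms] by (cases xs) auto
  finally have "(cycle_of_list xs \<circ> cycle_of_list (rev xs)) x = x" if "x \<in> set xs" for x
    using that map_eq_conv[of _ xs id] by (metis id_apply list.map_id)
  moreover have "(cycle_of_list xs \<circ> cycle_of_list (rev xs)) x = x" if "x \<notin> set xs" for x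
    using that by (simp add: id_outside_supp)
  ultimately have "cycle_of_list xs \<circ> cycle_of_list (rev xs) = id"
    by (metis eq_id_iff)
  then show ?thesis
    using permutes_inv_o(2)[OF cycle_permutes, of xs] by (metis comp_assoc comp_id id_comp)
qed

lemma cyclic_on_cycle_of_list:
  assumes "distinct xs" "xs \<noteq> []"
  shows "cyclic_on (cycle_of_list xs) (set xs)"
proof (rule cyclic_on_singleI)
  show "hd xs \<in> set xs"
    using assms by simp
  have nth: "(cycle_of_list xs ^^ n) (hd xs) = xs ! (n mod length xs)" for n
  proof -
    have "(cycle_of_list xs ^^ n) (hd xs) = hd (rotate n xs)"
      using cyclic_rotation[OF assms(1), of n] assms(2) by (metis hd_map)
    then show ?thesis
      using hd_rotate_conv_nth[OF assms(2)] by simp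
  qed
  show "set xs = orbit (cycle_of_list xs) (hd xs)"
  proof (intro equalityI subsetI)
    fix x assume "x \<in> set xs"
    then obtain i where i: "i < length xs" "x = xs ! i"
      by (auto simp: in_set_conv_nth)
    \<comment> \<open>One full extra turn, because \<open>orbit\<close> admits only positive powers
      and \<open>i\<close> may be 0.\<close>
    then have "x = (cycle_of_list xs ^^ (i + length xs)) (hd xs)" "0 < i + length xs"
      by (auto simp: nth)
    then show "x \<in> orbit (cycle_of_list xs) (hd xs)"
      unfolding orbit_altdef by blast
  next
    fix x assume "x \<in> orbit (cycle_of_list xs) (hd xs)"
    then show "x \<in> set xs"
      using assms(2) by (auto simp: orbit_altdef nth)
  qed
qed

text \<open>A cyclic order can be read off starting at any point; fixing the start \<open>x\<close>
  leaves only the orders of the other elements to enumerate.\<close>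

lemma cyclic_permutation_iff_cycle_of_list:
  assumes "finite S" "x \<in> S"
  shows "p permutes S \<and> cyclic_on p S \<longleftrightarrow>
    (\<exists>xs \<in> permutations_of_set (S - {x}). p = cycle_of_list (x # xs))"
proof
  assume p: "p permutes S \<and> cyclic_on p S"
  then have perm: "permutation p"
    using assms(1) permutation_permutes by blast
  \<comment> \<open>The list \<open>x, p x, p (p x), ...\<close> up to the first return to
    \<open>x\<close>.\<close>
  let ?xs = "support p x"
  have "least_power p x > 0"
    by (rule least_power_of_permutation(2)[OF perm])
  then obtain xs where xs: "?xs = x # xs"
    by (cases ?xs) (auto simp: map_eq_Cons_conv upt_eq_Cons_conv)
  have set: "set ?xs = S"
    using support_set[OF perm, of x] orbit_altdef_permutation[OF perm, of x]
      orbit_cyclic_eq3[of p S x] p assms(2) by auto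
  have "distinct ?xs"
    by (rule cycle_of_permutation[OF perm])
  with set xs have "xs \<in> permutations_of_set (S - {x})"
    by (auto simp: permutations_of_set_def)
  moreover have "p = cycle_of_list ?xs"
  proof
    fix y
    show "p y = cycle_of_list ?xs y"
    proof (cases "y \<in> S")
      case True
      then show ?thesis
        using cycle_restrict[OF perm] set by blast
    next
      case False
      then show ?thesis
        using p set id_outside_supp[of y ?xs] by (auto dest: permutes_not_in)
    qed
  qed
  ultimately show "\<exists>xs \<in> permutations_of_set (S - {x}). p = cycle_of_list (x # xs)"
    unfolding xs by blast
next
  assume "\<exists>xs \<in> permutations_of_set (S - {x}). p = cycle_of_list (x # xs)"
  then obtain xs where "set xs = S - {x}" "distinct xs" "p = cycle_of_list (x # xs)"
    by (auto simp: permutations_of_set_def)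
  moreover from this have "set (x # xs) = S"
    using assms(2) by auto
  ultimately show "p permutes S \<and> cyclic_on p S"
    using cycle_permutes[of "x # xs"] cyclic_on_cycle_of_list[of "x # xs"] by simp
qed


section \<open>Orbits of injective maps\<close>

lemma orbit_subset_invariant:
  assumes "f ` S \<subseteq> S" "x \<in> S"
  shows "orbit f x \<subseteq> S"
proof
  fix y assume "y \<in> orbit f x"
  then show "y \<in> S"
    by induction (use assms in auto)
qed

text \<open>Not automatic, as \<open>orbit\<close> starts at \<open>f x\<close>. Extended by the
  identity outside \<open>S\<close>, the map becomes a permutation of a finite set, and its orbits
  inside \<open>S\<close> are those of \<open>f\<close>.\<close>

lemma self_in_orbit_inj_on:
  assumes "finite S" "f ` S \<subseteq> S" "inj_on f S" "x \<in> S"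
  shows "x \<in> orbit f x"
proof -
  have "perm_restrict f S permutes S"
  proof (rule bij_imp_permutes)
    show "bij_betw (perm_restrict f S) S S"
      using endo_inj_surj[OF assms(1-3)] assms(3)
      by (auto simp: bij_betw_def perm_restrict_simps inj_on_def)
  qed (simp add: perm_restrict_simps)
  then have "x \<in> orbit (perm_restrict f S) x"
    using assms(1) permutation_permutes permutation_self_in_orbit by metis
  also have "orbit (perm_restrict f S) x = orbit f x"
    by (rule orbit_cong0[OF assms(4)]) (use assms(2) in \<open>auto simp: perm_restrict_simps\<close>)
  finally show ?thesis .
qed

lemma card_orbits_eq_1_iff:
  assumes "finite S" "f ` S \<subseteq> S" "inj_on f S" "x \<in> S"
  shows "card (orbit f ` S) = 1 \<longleftrightarrow> orbit f x = S"
proof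
  assume "card (orbit f ` S) = 1"
  then have "orbit f y = orbit f x" if "y \<in> S" for y
    using that assms(4) by (metis card_1_singletonE imageI singletonD)
  then have "S \<subseteq> orbit f x"
    using self_in_orbit_inj_on[OF assms(1-3)] by blast
  then show "orbit f x = S"
    using orbit_subset_invariant[OF assms(2,4)] by blast
next
  assume "orbit f x = S"
  then have "cyclic_on f S"
    using assms(4) by (auto simp: cyclic_on_def)
  then have "orbit f ` S = {S}"
    using assms(4) orbit_cyclic_eq3[of f S] by auto
  then show "card (orbit f ` S) = 1"
    by simp
qed

lemma orbit_eq_iff_no_early_return:
  assumes "finite S" "f ` S \<subseteq> S" "inj_on f S" "x \<in> S"
  shows "orbit f x = S \<longleftrightarrow> (\<forall>i. 0 < i \<and> i < card S \<longrightarrow> (f ^^ i) x \<noteq> x)"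
proof -
  \<comment> \<open>The period of \<open>x\<close>, which is also the size of its orbit.\<close>
  let ?p = "funpow_dist1 f x x"
  have self: "x \<in> orbit f x"
    by (rule self_in_orbit_inj_on[OF assms])
  have card: "card (orbit f x) = ?p"
    unfolding orbit_conv_funpow_dist1[OF self]
    by (subst card_image[OF inj_on_funpow_dist1[OF self]]) simp
  have "orbit f x = S \<longleftrightarrow> card S \<le> card (orbit f x)"
    using card_seteq[OF assms(1) orbit_subset_invariant[OF assms(2,4)]] by auto
  then have "orbit f x = S \<longleftrightarrow> card S \<le> ?p"
    by (simp only: card)
  moreover have "card S \<le> ?p \<longleftrightarrow> (\<forall>i. 0 < i \<and> i < card S \<longrightarrow> (f ^^ i) x \<noteq> x)"
    using funpow_dist1_prop[OF self] funpow_dist1_least[of _ f x x]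
    by (metis less_le_trans not_le zero_less_Suc)
  ultimately show ?thesis
    by simp
qed

text \<open>Carrying the current point along computes each iterate once, and the evaluation stops at
  the first return.\<close>

primrec avoids :: "('a \<Rightarrow> 'a) \<Rightarrow> 'a \<Rightarrow> nat \<Rightarrow> 'a \<Rightarrow> bool" where
  "avoids f x 0 y \<longleftrightarrow> True"
| "avoids f x (Suc n) y \<longleftrightarrow> (if y = x then False else avoids f x n (f y))"

lemma avoids_iff: "avoids f x n y \<longleftrightarrow> (\<forall>i<n. (f ^^ i) y \<noteq> x)"
  by (induction n arbitrary: y) (auto simp: less_Suc_eq_0_disj funpow_swap1)

lemma avoids_cong:
  assumes "f ` S \<subseteq> S" "\<And>z. z \<in> S \<Longrightarrow> g z = f z" "y \<in> S"
  shows "avoids g x n y \<longleftrightarrow> avoids f x n y"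
  using assms(3) by (induction n arbitrary: y) (use assms(1,2) in auto)

text \<open>The walk starts at \<open>f x\<close>, since \<open>avoids\<close> also tests its
  starting point; the iterates tested are thus those with exponents 1 to
  \<open>card S - 1\<close>.\<close>

lemma orbit_eq_iff_avoids:
  assumes "finite S" "f ` S \<subseteq> S" "inj_on f S" "x \<in> S"
  shows "orbit f x = S \<longleftrightarrow> avoids f x (card S - 1) (f x)"
  unfolding orbit_eq_iff_no_early_return[OF assms] avoids_iff
proof safe
  fix i assume "\<forall>i. 0 < i \<and> i < card S \<longrightarrow> (f ^^ i) x \<noteq> x" "i < card S - 1" "(f ^^ i) (f x) = x"
  then show False
    by (metis Suc_less_eq2 funpow_Suc_right less_diff_conv o_apply Suc_eq_plus1 zero_less_Suc)
next
  fix i assume *: "\<forall>i<card S - 1. (f ^^ i) (f x) \<noteq> x" "0 < i" "i < card S" "(f ^^ i) x = x"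
  then obtain j where "i = Suc j"
    by (cases i) auto
  with * show False
    by (simp add: funpow_swap1)
qed


section \<open>Isomorphism and equivalence of embeddings\<close>

lemma rotation_systemD:
  assumes "rotation_system G \<pi>"
  shows "v \<in> verts G \<Longrightarrow> \<pi> v permutes incident_edges G v" "bij (\<pi> v)"
  using assms unfolding rotation_system_def by (metis permutes_bij bij_id)+

lemma reversal_reversal:
  assumes "rotation_system G \<pi>"
  shows "reversal (reversal \<pi>) = \<pi>"
  unfolding reversal_def using rotation_systemD(2)[OF assms] by (simp add: inv_inv_eq)

lemma rotation_system_reversal:
  assumes "rotation_system G \<pi>"
  shows "rotation_system G (reversal \<pi>)"
proof -
  have "cyclic_on (inv p) S" if "p permutes S" "cyclic_on p S" for p and S :: "'b set"
  proof -
    have "permutation p"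
      using that finite_cyclic_on permutation_permutes by blast
    then show ?thesis
      using that(2) by (simp add: cyclic_on_def orbit_inv_eq)
  qed
  then show ?thesis
    using assms by (auto simp: rotation_system_def reversal_def permutes_inv)
qed

definition isomorphism ::
  "('v, 'e) multigraph \<Rightarrow> ('v \<Rightarrow> 'v) \<Rightarrow> ('e \<Rightarrow> 'e) \<Rightarrow> ('v \<Rightarrow> 'e \<Rightarrow> 'e) \<Rightarrow> ('v \<Rightarrow> 'e \<Rightarrow> 'e) \<Rightarrow> bool"
  where "isomorphism G \<alpha> \<beta> \<pi> \<pi>' \<longleftrightarrow> \<alpha> permutes verts G \<and> \<beta> permutes edges G \<and>
    (\<forall>e \<in> edges G. ends G (\<beta> e) = \<alpha> ` ends G e) \<and>
    (\<forall>v \<in> verts G. \<forall>e \<in> incident_edges G v. \<pi>' (\<alpha> v) (\<beta> e) = \<beta> (\<pi> v e))"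

lemma isomorphic_embeddings_iff_isomorphism:
  "isomorphic_embeddings G \<pi> \<pi>' \<longleftrightarrow> (\<exists>\<alpha> \<beta>. isomorphism G \<alpha> \<beta> \<pi> \<pi>')"
  by (simp add: isomorphic_embeddings_def isomorphism_def)

lemma isomorphismD:
  assumes "isomorphism G \<alpha> \<beta> \<pi> \<pi>'"
  shows "\<alpha> permutes verts G" "\<beta> permutes edges G"
    and "e \<in> edges G \<Longrightarrow> ends G (\<beta> e) = \<alpha> ` ends G e"
    and "v \<in> verts G \<Longrightarrow> e \<in> incident_edges G v \<Longrightarrow> \<pi>' (\<alpha> v) (\<beta> e) = \<beta> (\<pi> v e)"
  using assms by (simp_all add: isomorphism_def)

lemma isomorphism_incident_edges:
  assumes "isomorphism G \<alpha> \<beta> \<pi> \<pi>'" "e \<in> incident_edges G v"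
  shows "\<beta> e \<in> incident_edges G (\<alpha> v)"
  using assms(2) isomorphismD(3)[OF assms(1)]
  by (auto simp: incident_edges_def permutes_in_image[OF isomorphismD(2)[OF assms(1)]])

lemma isomorphism_id: "isomorphism G id id \<pi> \<pi>"
  by (simp add: isomorphism_def permutes_id)

lemma isomorphism_comp:
  assumes "isomorphism G \<alpha> \<beta> \<pi>\<^sub>1 \<pi>\<^sub>2" "isomorphism G \<alpha>' \<beta>' \<pi>\<^sub>2 \<pi>\<^sub>3"
  shows "isomorphism G (\<alpha>' \<circ> \<alpha>) (\<beta>' \<circ> \<beta>) \<pi>\<^sub>1 \<pi>\<^sub>3"
proof -
  note 1 = isomorphismD[OF assms(1)] and 2 = isomorphismD[OF assms(2)]
  have "\<alpha>' \<circ> \<alpha> permutes verts G" "\<beta>' \<circ> \<beta> permutes edges G"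
    using 1(1,2) 2(1,2) by (auto intro: permutes_compose)
  moreover have "ends G ((\<beta>' \<circ> \<beta>) e) = (\<alpha>' \<circ> \<alpha>) ` ends G e" if "e \<in> edges G" for e
    using that 1(3) 2(3)[of "\<beta> e"] by (simp add: permutes_in_image[OF 1(2)] image_comp)
  moreover have "\<pi>\<^sub>3 ((\<alpha>' \<circ> \<alpha>) v) ((\<beta>' \<circ> \<beta>) e) = (\<beta>' \<circ> \<beta>) (\<pi>\<^sub>1 v e)"
    if "v \<in> verts G" "e \<in> incident_edges G v" for v e
    using that 1(4) 2(4)[of "\<alpha> v" "\<beta> e"] isomorphism_incident_edges[OF assms(1)]
    by (simp add: permutes_in_image[OF 1(1)])
  ultimately show ?thesis
    by (simp add: isomorphism_def)
qed

lemma isomorphism_inv: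
  assumes "isomorphism G \<alpha> \<beta> \<pi> \<pi>'"
  shows "isomorphism G (inv \<alpha>) (inv \<beta>) \<pi>' \<pi>"
proof -
  note iso = isomorphismD[OF assms]
  note inverses = permutes_inverses[OF iso(1)] permutes_inverses[OF iso(2)]
  note inv_in = permutes_in_image[OF permutes_inv[OF iso(1)]]
    permutes_in_image[OF permutes_inv[OF iso(2)]]
  have ends: "ends G (inv \<beta> e) = inv \<alpha> ` ends G e" if "e \<in> edges G" for e
    using iso(3)[of "inv \<beta> e"] that by (simp add: inv_in inverses image_comp comp_def)
  have "\<pi> (inv \<alpha> v) (inv \<beta> e) = inv \<beta> (\<pi>' v e)"
    if "v \<in> verts G" "e \<in> incident_edges G v" for v e
  proof -
    have "inv \<beta> e \<in> incident_edges G (inv \<alpha> v)"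
      using that(2) ends by (auto simp: incident_edges_def inv_in)
    then have "\<pi>' v e = \<beta> (\<pi> (inv \<alpha> v) (inv \<beta> e))"
      using iso(4)[of "inv \<alpha> v" "inv \<beta> e"] that(1) by (simp add: inv_in inverses)
    then show ?thesis
      by (simp add: inverses)
  qed
  with ends show ?thesis
    by (simp add: isomorphism_def permutes_inv[OF iso(1)] permutes_inv[OF iso(2)])
qed

text \<open>If \<beta> conjugates the rotation at \<open>v\<close> to the one at
  \<open>\<alpha> v\<close>, it conjugates their inverses too.\<close>

lemma isomorphism_reversal:
  assumes "rotation_system G \<pi>" "rotation_system G \<pi>'" "isomorphism G \<alpha> \<beta> \<pi> \<pi>'"
  shows "isomorphism G \<alpha> \<beta> (reversal \<pi>) (reversal \<pi>')"
proof -
  note iso = isomorphismD[OF assms(3)]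
  have "inv (\<pi>' (\<alpha> v)) (\<beta> e) = \<beta> (inv (\<pi> v) e)" if "v \<in> verts G" "e \<in> incident_edges G v" for v e
  proof -
    note perm = rotation_systemD(1)[OF assms(1) that(1)]
    have "inv (\<pi> v) e \<in> incident_edges G v"
      using that(2) by (simp add: permutes_in_image[OF permutes_inv[OF perm]])
    then have "\<pi>' (\<alpha> v) (\<beta> (inv (\<pi> v) e)) = \<beta> e"
      using iso(4)[OF that(1)] by (simp add: permutes_inverses[OF perm])
    then show ?thesis
      using rotation_systemD(2)[OF assms(2)] by (metis bij_inv_eq_iff)
  qed
  with iso(1-3) show ?thesis
    by (simp add: isomorphism_def reversal_def)
qed

lemma isomorphic_embeddings_refl: "isomorphic_embeddings G \<pi> \<pi>"
  using isomorphism_id isomorphic_embeddings_iff_isomorphism by blast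

lemma isomorphic_embeddings_sym:
  "isomorphic_embeddings G \<pi> \<pi>' \<Longrightarrow> isomorphic_embeddings G \<pi>' \<pi>"
  unfolding isomorphic_embeddings_iff_isomorphism using isomorphism_inv by blast

lemma isomorphic_embeddings_trans:
  "isomorphic_embeddings G \<pi>\<^sub>1 \<pi>\<^sub>2 \<Longrightarrow> isomorphic_embeddings G \<pi>\<^sub>2 \<pi>\<^sub>3 \<Longrightarrow>
    isomorphic_embeddings G \<pi>\<^sub>1 \<pi>\<^sub>3"
  unfolding isomorphic_embeddings_iff_isomorphism using isomorphism_comp by blast

lemma isomorphic_embeddings_reversal:
  assumes "rotation_system G \<pi>" "rotation_system G \<pi>'" "isomorphic_embeddings G \<pi> \<pi>'"
  shows "isomorphic_embeddings G (reversal \<pi>) (reversal \<pi>')"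
  using assms(3) isomorphism_reversal[OF assms(1,2)]
  unfolding isomorphic_embeddings_iff_isomorphism by blast

lemma isomorphic_embeddings_reversal_left:
  assumes "rotation_system G \<pi>" "rotation_system G \<pi>'" "isomorphic_embeddings G (reversal \<pi>) \<pi>'"
  shows "isomorphic_embeddings G \<pi> (reversal \<pi>')"
  using isomorphic_embeddings_reversal[OF rotation_system_reversal[OF assms(1)] assms(2,3)]
  by (simp add: reversal_reversal[OF assms(1)])

text \<open>Reversal is an involution and respects isomorphism, so two reversals in a chain of
  equivalences cancel.\<close>

lemma equiv_embedding_equiv: "equiv (embeddings G g) (embedding_equiv G g)"
proof (rule equivI)
  show "embedding_equiv G g \<subseteq> embeddings G g \<times> embeddings G g"
    by (auto simp: embedding_equiv_def)
  show "refl_on (embeddings G g) (embedding_equiv G g)"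
    by (auto simp: refl_on_def embedding_equiv_def equivalent_embeddings_def isomorphic_embeddings_refl)
  show "sym (embedding_equiv G g)"
    unfolding sym_def embedding_equiv_def equivalent_embeddings_def embeddings_def
    using isomorphic_embeddings_sym isomorphic_embeddings_reversal_left by blast
  show "trans (embedding_equiv G g)"
    unfolding trans_def embedding_equiv_def equivalent_embeddings_def embeddings_def
    using isomorphic_embeddings_trans isomorphic_embeddings_reversal
      isomorphic_embeddings_reversal_left by blast
qed

lemma nonorientable_embedding_equiv:
  assumes "(\<pi>, \<pi>') \<in> embedding_equiv G g" "nonorientable_embedding G \<pi>"
  shows "nonorientable_embedding G \<pi>'"
proof -
  have rs: "rotation_system G \<pi>" "rotation_system G \<pi>'"
    and eq: "isomorphic_embeddings G \<pi> \<pi>' \<or> isomorphic_embeddings G (reversal \<pi>) \<pi>'"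
    using assms(1) by (auto simp: embedding_equiv_def embeddings_def equivalent_embeddings_def)
  have mirror: "isomorphic_embeddings G (reversal \<pi>) \<pi>"
    using assms(2) by (simp add: nonorientable_embedding_def)
  \<comment> \<open>Being isomorphic to its mirror image, \<pi> reaches \<pi>' by isomorphism in
    either case of \<open>eq\<close>.\<close>
  have "isomorphic_embeddings G \<pi> \<pi>'"
    using eq mirror isomorphic_embeddings_sym isomorphic_embeddings_trans by blast
  then show ?thesis
    unfolding nonorientable_embedding_def
    using mirror isomorphic_embeddings_reversal[OF rs] isomorphic_embeddings_sym
      isomorphic_embeddings_trans by blast
qed

text \<open>Sending a representative to its class is onto by the fourth assumption and injective by
  the fifth.\<close>

lemma card_quotient_representatives:
  assumes "equiv A R" "B \<subseteq> A" "S \<subseteq> B"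
    and "\<And>x. x \<in> B \<Longrightarrow> \<exists>r\<in>S. (r, x) \<in> R"
    and "\<And>r s. r \<in> S \<Longrightarrow> s \<in> S \<Longrightarrow> (r, s) \<in> R \<Longrightarrow> r = s"
  shows "card (B // R) = card S"
proof -
  have "B // R = (\<lambda>r. R `` {r}) ` S"
  proof (intro equalityI subsetI)
    fix X assume "X \<in> B // R"
    then obtain x where "x \<in> B" "X = R `` {x}"
      by (auto elim: quotientE)
    then show "X \<in> (\<lambda>r. R `` {r}) ` S"
      using assms(4)[of x] equiv_class_eq[OF assms(1)] by blast
  qed (use assms(3) in \<open>auto intro: quotientI\<close>)
  moreover have "inj_on (\<lambda>r. R `` {r}) S"
    using assms(2,3,5) eq_equiv_class[OF _ assms(1)] by (intro inj_onI) blast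
  ultimately show ?thesis
    by (simp add: card_image)
qed


section \<open>Faces\<close>

locale loopless_multigraph =
  fixes G :: "('v, 'e) multigraph"
  assumes card_ends: "e \<in> edges G \<Longrightarrow> card (ends G e) = 2"
    and ends_verts: "e \<in> edges G \<Longrightarrow> ends G e \<subseteq> verts G"
begin

lemma other_end:
  assumes "e \<in> incident_edges G v"
  shows "ends G e = {v, other_end G v e}" "other_end G v e \<noteq> v"
proof -
  have e: "e \<in> edges G" "v \<in> ends G e"
    using assms by (auto simp: incident_edges_def)
  then obtain w where w: "ends G e = {v, w}" "w \<noteq> v"
    using card_ends[OF e(1)] unfolding card_2_iff by (metis doubleton_eq_iff insertE singletonD)
  then have "other_end G v e = w"
    unfolding other_end_def by (intro the_equality) (auto simp: doubleton_eq_iff)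
  with w show "ends G e = {v, other_end G v e}" "other_end G v e \<noteq> v"
    by auto
qed

lemma incident_edges_other_end:
  assumes "e \<in> incident_edges G v"
  shows "e \<in> incident_edges G (other_end G v e)" "other_end G v e \<in> verts G"
  using other_end(1)[OF assms] ends_verts assms by (auto simp: incident_edges_def)

lemma face_step_darts:
  assumes "rotation_system G \<pi>"
  shows "face_step G \<pi> ` darts G \<subseteq> darts G"
proof -
  have "\<pi> (other_end G v e) e \<in> incident_edges G (other_end G v e)" if "e \<in> incident_edges G v" for v e
    using rotation_systemD(1)[OF assms] incident_edges_other_end[OF that] by (simp add: permutes_in_image)
  then show ?thesis
    using incident_edges_other_end by (auto simp: darts_def face_step_def)
qed

text \<open>Invertibility of the rotation at the common head recovers the edge; the edge and its
  head determine the tail.\<close>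

lemma inj_on_face_step:
  assumes "rotation_system G \<pi>"
  shows "inj_on (face_step G \<pi>) (darts G)"
proof (intro inj_onI, clarsimp simp: darts_def face_step_def)
  fix v e v' e'
  assume e: "e \<in> incident_edges G v" and e': "e' \<in> incident_edges G v'"
    and w: "other_end G v e = other_end G v' e'"
    and "\<pi> (other_end G v' e') e = \<pi> (other_end G v' e') e'"
  then have "e = e'"
    using rotation_systemD(2)[OF assms] by (meson bij_is_inj injD)
  then show "v = v' \<and> e = e'"
    using other_end(1)[OF e] other_end(1)[OF e'] w by (metis doubleton_eq_iff)
qed

lemma card_faces_eq_1_iff:
  assumes "rotation_system G \<pi>" "finite (darts G)" "d \<in> darts G"
  shows "card (faces G \<pi>) = 1 \<longleftrightarrow>
    avoids (face_step G \<pi>) d (card (darts G) - 1) (face_step G \<pi> d)"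
proof -
  note step = assms(2) face_step_darts[OF assms(1)] inj_on_face_step[OF assms(1)] assms(3)
  show ?thesis
    unfolding faces_def card_orbits_eq_1_iff[OF step] by (rule orbit_eq_iff_avoids[OF step])
qed

end

section \<open>Rotation systems of \<open>K\<^sub>4\<^sup>+\<close>\<close>

text \<open>
  A rotation system is encoded by the list of its rotations at 0, 1, 2, 3, each rotation being
  given by a list of edges in cyclic order.
\<close>

definition rotations :: "nat list list \<Rightarrow> nat \<Rightarrow> nat \<Rightarrow> nat" where
  "rotations c v = (if v < 4 then cycle_of_list (c ! v) else id)"

text \<open>Each rotation starts with its smallest edge, which selects one list per cyclic order: 3!
  * 3! * 2! * 2! = 144.\<close>

definition K4_plus_codes :: "nat list list list" where
  "K4_plus_codes = [[0 # p, 0 # q, 2 # r, 3 # s].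
     p \<leftarrow> permutations_of_set_list [1, 2, 3], q \<leftarrow> permutations_of_set_list [1, 4, 5],
     r \<leftarrow> permutations_of_set_list [4, 6], s \<leftarrow> permutations_of_set_list [5, 6]]"

text \<open>Reversing a code in \<open>K4_plus_codes\<close> moves the smallest edges away from the
  front and so leaves that list. This weaker condition is closed under
  \<open>map rev\<close>.\<close>

definition valid_code :: "nat list list \<Rightarrow> bool" where
  "valid_code c \<longleftrightarrow> length c = 4 \<and>
    (\<forall>v \<in> verts K4_plus. distinct (c ! v) \<and> set (c ! v) = incident_edges K4_plus v)"

lemma verts_K4_plus: "verts K4_plus = {0, 1, 2, 3}"
  by (simp add: K4_plus_def)

lemma edges_K4_plus: "edges K4_plus = {0, 1, 2, 3, 4, 5, 6}"
  by (auto simp: K4_plus_def)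

lemma ends_K4_plus:
  "ends K4_plus 0 = {0, 1}" "ends K4_plus (Suc 0) = {0, 1}" "ends K4_plus 2 = {0, 2}"
  "ends K4_plus 3 = {0, 3}" "ends K4_plus 4 = {1, 2}" "ends K4_plus 5 = {1, 3}"
  "ends K4_plus 6 = {2, 3}"
  by (simp_all add: K4_plus_def)

lemma incident_edges_K4_plus:
  "incident_edges K4_plus 0 = {0, 1, 2, 3}" "incident_edges K4_plus (Suc 0) = {0, 1, 4, 5}"
  "incident_edges K4_plus 2 = {2, 4, 6}" "incident_edges K4_plus 3 = {3, 5, 6}"
  unfolding incident_edges_def edges_K4_plus by (auto simp: ends_K4_plus)

interpretation K4_plus: loopless_multigraph K4_plus
proof
  fix e assume "e \<in> edges K4_plus"
  then show "card (ends K4_plus e) = 2" "ends K4_plus e \<subseteq> verts K4_plus"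
    by (auto simp: edges_K4_plus verts_K4_plus ends_K4_plus)
qed

lemma rotation_system_K4_plus_iff:
  "rotation_system K4_plus \<pi> \<longleftrightarrow> (\<exists>c \<in> set K4_plus_codes. \<pi> = rotations c)"
proof -
  let ?cyc = "\<lambda>v. \<pi> v permutes incident_edges K4_plus v \<and> cyclic_on (\<pi> v) (incident_edges K4_plus v)"
  have cyc: "?cyc v \<longleftrightarrow> (\<exists>xs \<in> set (permutations_of_set_list ys). \<pi> v = cycle_of_list (y # xs))"
    if "incident_edges K4_plus v = set (y # ys)" "distinct (y # ys)" for v y ys
  proof -
    have "incident_edges K4_plus v - {y} = set ys"
      using that by auto
    then show ?thesis
      using cyclic_permutation_iff_cycle_of_list[of "incident_edges K4_plus v" y "\<pi> v"] that
      by (simp add: permutations_of_list_code distinct_remdups_id)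
  qed
  have "v \<notin> verts K4_plus \<longleftrightarrow> 4 \<le> v" for v
    by (auto simp: verts_K4_plus)
  then have "rotation_system K4_plus \<pi> \<longleftrightarrow>
      (\<forall>v. 4 \<le> v \<longrightarrow> \<pi> v = id) \<and> ?cyc 0 \<and> ?cyc 1 \<and> ?cyc 2 \<and> ?cyc 3"
    unfolding rotation_system_def by (auto simp: verts_K4_plus)
  also have "\<dots> \<longleftrightarrow> (\<forall>v. 4 \<le> v \<longrightarrow> \<pi> v = id) \<and>
      (\<exists>p \<in> set (permutations_of_set_list [1, 2, 3]). \<pi> 0 = cycle_of_list (0 # p)) \<and>
      (\<exists>q \<in> set (permutations_of_set_list [1, 4, 5]). \<pi> 1 = cycle_of_list (0 # q)) \<and>
      (\<exists>r \<in> set (permutations_of_set_list [4, 6]). \<pi> 2 = cycle_of_list (2 # r)) \<and>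
      (\<exists>s \<in> set (permutations_of_set_list [5, 6]). \<pi> 3 = cycle_of_list (3 # s))"
    by (intro arg_cong2[where f = "(\<and>)"] refl cyc) (simp_all add: incident_edges_K4_plus)
  also have "\<dots> \<longleftrightarrow> (\<exists>p \<in> set (permutations_of_set_list [1, 2, 3]).
      \<exists>q \<in> set (permutations_of_set_list [1, 4, 5]). \<exists>r \<in> set (permutations_of_set_list [4, 6]).
      \<exists>s \<in> set (permutations_of_set_list [5, 6]). \<pi> = rotations [0 # p, 0 # q, 2 # r, 3 # s])"
  proof -
    \<comment> \<open>Equality of functions splits into four values at vertices and the identity
      elsewhere; this is why \<open>rotations\<close> defaults to \<open>id\<close>.\<close>
    have "\<pi> = rotations [p, q, r, s] \<longleftrightarrow> (\<forall>v. 4 \<le> v \<longrightarrow> \<pi> v = id) \<and>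
        \<pi> 0 = cycle_of_list p \<and> \<pi> 1 = cycle_of_list q \<and> \<pi> 2 = cycle_of_list r \<and> \<pi> 3 = cycle_of_list s"
      (is "_ \<longleftrightarrow> ?R") for p q r s
    proof
      assume ?R
      then have "\<pi> v = rotations [p, q, r, s] v" for v
        by (cases "v \<in> {0, 1, 2, 3}") (auto simp: rotations_def)
      then show "\<pi> = rotations [p, q, r, s]"
        by blast
    qed (simp add: rotations_def)
    then show ?thesis
      by (simp only:) blast
  qed
  also have "\<dots> \<longleftrightarrow> (\<exists>c \<in> set K4_plus_codes. \<pi> = rotations c)"
    unfolding K4_plus_codes_def by (simp del: cycle_of_list.simps)
  finally show ?thesis .
qed

lemma valid_code_K4_plus_codes:
  assumes "c \<in> set K4_plus_codes"
  shows "valid_code c"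
proof -
  have perms: "set (permutations_of_set_list ys) = permutations_of_set (set ys)"
    if "distinct ys" for ys :: "nat list"
    using permutations_of_list_code[of ys] that by (simp add: distinct_remdups_id)
  obtain p q r s where "c = [0 # p, 0 # q, 2 # r, 3 # s]"
    "p \<in> permutations_of_set {1, 2, 3}" "q \<in> permutations_of_set {1, 4, 5}"
    "r \<in> permutations_of_set {4, 6}" "s \<in> permutations_of_set {5, 6}"
    using assms perms[of "[1, 2, 3]"] perms[of "[1, 4, 5]"] perms[of "[4, 6]"] perms[of "[5, 6]"]
    by (auto simp: K4_plus_codes_def)
  then show ?thesis
    by (auto simp: valid_code_def verts_K4_plus incident_edges_K4_plus permutations_of_set_def)
qed

lemma valid_code_rev:
  assumes "valid_code c"
  shows "valid_code (map rev c)" "rotations (map rev c) = reversal (rotations c)"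
proof -
  have nth: "map rev c ! v = rev (c ! v)" if "v < 4" for v
    using assms that by (simp add: valid_code_def)
  then show "valid_code (map rev c)"
    using assms by (auto simp: valid_code_def verts_K4_plus)
  show "rotations (map rev c) = reversal (rotations c)"
  proof
    fix v
    have "v \<in> verts K4_plus" if "v < 4"
      using that by (auto simp: verts_K4_plus)
    then show "rotations (map rev c) v = reversal (rotations c) v"
      using assms nth inv_cycle_of_list[of "c ! v"]
      by (auto simp: rotations_def reversal_def valid_code_def)
  qed
qed

lemma next_in_valid_code:
  assumes "valid_code c" "v \<in> verts K4_plus" "e \<in> incident_edges K4_plus v"
  shows "next_in (c ! v) e = rotations c v e" "rotations c v e \<in> incident_edges K4_plus v"
proof -
  have "v < 4"
    using assms(2) by (auto simp: verts_K4_plus)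
  then show "next_in (c ! v) e = rotations c v e" "rotations c v e \<in> incident_edges K4_plus v"
    using assms next_in_eq_cycle_of_list[of "c ! v" e] permutes_in_image[OF cycle_permutes, of "c ! v" e]
    by (simp_all add: valid_code_def rotations_def)
qed

section \<open>Face tracing on codes\<close>

definition K4_plus_darts :: "(nat \<times> nat) list" where
  "K4_plus_darts = [(0, 0), (0, 1), (0, 2), (0, 3), (1, 0), (1, 1), (1, 4), (1, 5),
     (2, 2), (2, 4), (2, 6), (3, 3), (3, 5), (3, 6)]"

lemma darts_K4_plus: "darts K4_plus = set K4_plus_darts"
proof -
  have "darts K4_plus = (\<Union>v \<in> verts K4_plus. Pair v ` incident_edges K4_plus v)"
    by (auto simp: darts_def)
  then show ?thesis
    by (simp add: verts_K4_plus incident_edges_K4_plus K4_plus_darts_def insert_commute)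
qed

lemma card_darts_K4_plus: "card (darts K4_plus) = 14"
  unfolding darts_K4_plus K4_plus_darts_def by simp

text \<open>The table lists the sums of the two ends of each edge.\<close>

fun code_step :: "nat list list \<Rightarrow> nat \<times> nat \<Rightarrow> nat \<times> nat" where
  "code_step c (v, e) = (let w = [1, 1, 2, 3, 3, 4, 5] ! e - v in (w, next_in (c ! w) e))"

text \<open>There are 14 darts, and the face through \<open>(0, 0)\<close> contains all of them iff
  none of the iterates 1 to 13 returns.\<close>

definition one_face :: "nat list list \<Rightarrow> bool" where
  "one_face c \<longleftrightarrow> avoids (code_step c) (0, 0) 13 (code_step c (0, 0))"

lemma other_end_K4_plus:
  assumes "e \<in> incident_edges K4_plus v"
  shows "other_end K4_plus v e = [1, 1, 2, 3, 3, 4, 5] ! e - v"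
proof -
  have "e \<in> {0, 1, 2, 3, 4, 5, 6}"
    using assms by (simp add: incident_edges_def edges_K4_plus)
  then show ?thesis
    using K4_plus.other_end[OF assms] by (auto simp: ends_K4_plus doubleton_eq_iff)
qed

lemma code_step_eq_face_step:
  assumes "valid_code c" "d \<in> darts K4_plus"
  shows "code_step c d = face_step K4_plus (rotations c) d"
proof -
  obtain v e where d: "d = (v, e)" "e \<in> incident_edges K4_plus v"
    using assms(2) by (auto simp: darts_def)
  show ?thesis
    using next_in_valid_code(1)[OF assms(1)] K4_plus.incident_edges_other_end[OF d(2)]
    unfolding d(1) code_step.simps other_end_K4_plus[OF d(2), symmetric] by (simp add: face_step_def Let_def)
qed

lemma rotations_in_embeddings_iff:
  assumes "c \<in> set K4_plus_codes"
  shows "rotations c \<in> embeddings K4_plus 2 \<longleftrightarrow> one_face c"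
proof -
  have rs: "rotation_system K4_plus (rotations c)"
    using assms rotation_system_K4_plus_iff by blast
  have fin: "finite (darts K4_plus)" and dart: "(0, 0) \<in> darts K4_plus"
    by (simp_all add: darts_K4_plus K4_plus_darts_def)
  have step: "code_step c d = face_step K4_plus (rotations c) d" if "d \<in> darts K4_plus" for d
    by (rule code_step_eq_face_step[OF valid_code_K4_plus_codes[OF assms] that])
  have face: "face_step K4_plus (rotations c) (0, 0) \<in> darts K4_plus"
    using K4_plus.face_step_darts[OF rs] dart by blast
  have "card (verts K4_plus) = 4" "card (edges K4_plus) = 7"
    by (simp_all add: verts_K4_plus edges_K4_plus)
  \<comment> \<open>From 4 - 7 + F = 2 - 2 * 2 follows F = 1.\<close>
  then have "rotations c \<in> embeddings K4_plus 2 \<longleftrightarrow> card (faces K4_plus (rotations c)) = 1"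
    using rs by (auto simp: embeddings_def)
  also have "\<dots> \<longleftrightarrow> one_face c"
    unfolding K4_plus.card_faces_eq_1_iff[OF rs fin dart] one_face_def card_darts_K4_plus step[OF dart]
    using avoids_cong[OF K4_plus.face_step_darts[OF rs] step face] by simp
  finally show ?thesis .
qed


section \<open>Automorphisms of \<open>K\<^sub>4\<^sup>+\<close>\<close>

text \<open>Lists of images of vertices and of edges. Edges 2 to 6 have no parallel, so the vertex
  map forces their images; only edges 0 and 1 leave a choice.\<close>

definition K4_plus_autos :: "(nat list \<times> nat list) list" where
  "K4_plus_autos =
    [([0, 1, 2, 3], [0, 1, 2, 3, 4, 5, 6]), ([0, 1, 2, 3], [1, 0, 2, 3, 4, 5, 6]),
     ([0, 1, 3, 2], [0, 1, 3, 2, 5, 4, 6]), ([0, 1, 3, 2], [1, 0, 3, 2, 5, 4, 6]),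
     ([1, 0, 2, 3], [0, 1, 4, 5, 2, 3, 6]), ([1, 0, 2, 3], [1, 0, 4, 5, 2, 3, 6]),
     ([1, 0, 3, 2], [0, 1, 5, 4, 3, 2, 6]), ([1, 0, 3, 2], [1, 0, 5, 4, 3, 2, 6])]"

definition list_perm :: "nat list \<Rightarrow> nat \<Rightarrow> nat" where
  "list_perm xs i = (if i < length xs then xs ! i else i)"

lemma list_perm_permutes:
  assumes "distinct xs" "set xs = {..<length xs}"
  shows "list_perm xs permutes {..<length xs}"
proof (rule bij_imp_permutes)
  show "bij_betw (list_perm xs) {..<length xs} {..<length xs}"
    using bij_betw_nth[OF assms(1) refl assms(2)[symmetric]]
    by (rule bij_betw_cong[THEN iffD1, rotated]) (simp add: list_perm_def)
qed (simp add: list_perm_def)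

lemma K4_plus_autos_sound:
  assumes "(a, b) \<in> set K4_plus_autos"
  shows "list_perm a permutes verts K4_plus" "list_perm b permutes edges K4_plus"
    and "\<And>e. e \<in> edges K4_plus \<Longrightarrow> ends K4_plus (list_perm b e) = list_perm a ` ends K4_plus e"
    and "\<And>v. v \<in> verts K4_plus \<Longrightarrow> list_perm a v = a ! v"
    and "\<And>e. e \<in> edges K4_plus \<Longrightarrow> list_perm b e = b ! e"
proof -
  have sets: "{..<4::nat} = {0, 1, 2, 3}" "{..<7::nat} = {0, 1, 2, 3, 4, 5, 6}"
    by auto
  have a: "length a = 4" "distinct a" "set a = {..<4}"
    and b: "length b = 7" "distinct b" "set b = {..<7}"
    using assms unfolding K4_plus_autos_def sets by auto
  have "verts K4_plus = {..<length a}" "edges K4_plus = {..<length b}"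
    unfolding a b sets verts_K4_plus edges_K4_plus by simp_all
  then show "list_perm a permutes verts K4_plus" "list_perm b permutes edges K4_plus"
    using list_perm_permutes[of a] list_perm_permutes[of b] a b by simp_all
  show \<alpha>: "list_perm a v = a ! v" if "v \<in> verts K4_plus" for v
    using that by (auto simp: list_perm_def verts_K4_plus a(1))
  show \<beta>: "list_perm b e = b ! e" if "e \<in> edges K4_plus" for e
    using that by (auto simp: list_perm_def edges_K4_plus b(1))
  have "\<forall>e \<in> edges K4_plus. ends K4_plus (b ! e) = (!) a ` ends K4_plus e"
    using assms unfolding K4_plus_autos_def edges_K4_plus list.set
    by (elim insertE emptyE Pair_inject) (simp_all add: ends_K4_plus insert_commute)
  moreover have "list_perm a ` ends K4_plus e = (!) a ` ends K4_plus e" if "e \<in> edges K4_plus" for e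
    using K4_plus.ends_verts[OF that] \<alpha> by (intro image_cong) auto
  ultimately show "ends K4_plus (list_perm b e) = list_perm a ` ends K4_plus e"
    if "e \<in> edges K4_plus" for e
    using \<beta>[OF that] that by simp
qed

text \<open>Edges 0 and 1 are the only parallel pair, so \<beta> preserves that pair, hence \<alpha>
  preserves \<open>{0, 1}\<close> and \<open>{2, 3}\<close>. Every other edge is determined by its
  ends.\<close>

lemma K4_plus_autos_complete:
  assumes "\<alpha> permutes verts K4_plus" "\<beta> permutes edges K4_plus"
    and "\<And>e. e \<in> edges K4_plus \<Longrightarrow> ends K4_plus (\<beta> e) = \<alpha> ` ends K4_plus e"
  shows "\<exists>(a, b) \<in> set K4_plus_autos.
    (\<forall>v \<in> verts K4_plus. \<alpha> v = a ! v) \<and> (\<forall>e \<in> edges K4_plus. \<beta> e = b ! e)"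
proof -
  have \<beta>: "\<beta> e \<in> {0, 1, 2, 3, 4, 5, 6}" if "e \<in> {0, 1, 2, 3, 4, 5, 6}" for e
    using that permutes_in_image[OF assms(2)] by (simp add: edges_K4_plus)
  have \<alpha>: "\<alpha> v \<in> {0, 1, 2, 3}" if "v \<in> {0, 1, 2, 3}" for v
    using that permutes_in_image[OF assms(1)] by (simp add: verts_K4_plus)
  have inj: "\<alpha> v = \<alpha> w \<longleftrightarrow> v = w" "\<beta> e = \<beta> f \<longleftrightarrow> e = f" for v w e f
    using permutes_inj[OF assms(1)] permutes_inj[OF assms(2)] by (auto dest: injD)
  have ends: "ends K4_plus (\<beta> 0) = {\<alpha> 0, \<alpha> 1}" "ends K4_plus (\<beta> 1) = {\<alpha> 0, \<alpha> 1}"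
    "ends K4_plus (\<beta> 2) = {\<alpha> 0, \<alpha> 2}" "ends K4_plus (\<beta> 3) = {\<alpha> 0, \<alpha> 3}"
    "ends K4_plus (\<beta> 4) = {\<alpha> 1, \<alpha> 2}" "ends K4_plus (\<beta> 5) = {\<alpha> 1, \<alpha> 3}"
    "ends K4_plus (\<beta> 6) = {\<alpha> 2, \<alpha> 3}"
    using assms(3) by (simp_all add: edges_K4_plus ends_K4_plus)
  have parallel: "e \<in> {0, 1}"
    if "e \<in> {0, 1, 2, 3, 4, 5, 6}" "f \<in> {0, 1, 2, 3, 4, 5, 6}" "e \<noteq> f"
      "ends K4_plus e = ends K4_plus f" for e f
    using that by (auto simp: ends_K4_plus doubleton_eq_iff)
  have \<beta>01: "\<beta> 0 \<in> {0, 1}" "\<beta> 1 \<in> {0, 1}" "\<beta> 0 \<noteq> \<beta> 1"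
    using parallel[of "\<beta> 0" "\<beta> 1"] parallel[of "\<beta> 1" "\<beta> 0"] \<beta>[of 0] \<beta>[of 1] ends inj by auto
  have "ends K4_plus (\<beta> 0) = {0, 1}"
    using \<beta>01(1) by (elim insertE emptyE) (simp_all add: ends_K4_plus)
  then have "{\<alpha> 0, \<alpha> 1} = {0, 1}"
    unfolding ends(1) .
  moreover from this have "{\<alpha> 2, \<alpha> 3} = {2, 3}"
    using \<alpha>[of 2] \<alpha>[of 3] inj(1)[of 0 2] inj(1)[of 0 3] inj(1)[of 1 2] inj(1)[of 1 3] inj(1)[of 2 3]
    by (auto simp: doubleton_eq_iff)
  ultimately have vs: "\<alpha> 0 = 0 \<and> \<alpha> 1 = 1 \<or> \<alpha> 0 = 1 \<and> \<alpha> 1 = 0"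
    "\<alpha> 2 = 2 \<and> \<alpha> 3 = 3 \<or> \<alpha> 2 = 3 \<and> \<alpha> 3 = 2"
    by (simp_all add: doubleton_eq_iff)
  have \<beta>_eq: "\<beta> e = f"
    if "ends K4_plus (\<beta> e) = ends K4_plus f" "e \<in> {0, 1, 2, 3, 4, 5, 6}" "f \<in> {2, 3, 4, 5, 6}" for e f
    using parallel[of f "\<beta> e"] \<beta>[OF that(2)] that(1,3) by auto
  have case1: "\<beta> 2 = 2 \<and> \<beta> 3 = 3 \<and> \<beta> 4 = 4 \<and> \<beta> 5 = 5 \<and> \<beta> 6 = 6"
    if "\<alpha> 0 = 0 \<and> \<alpha> 1 = 1 \<and> \<alpha> 2 = 2 \<and> \<alpha> 3 = 3"
    by (intro conjI \<beta>_eq) (simp_all add: ends ends_K4_plus that[unfolded One_nat_def] insert_commute)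
  have case2: "\<beta> 2 = 3 \<and> \<beta> 3 = 2 \<and> \<beta> 4 = 5 \<and> \<beta> 5 = 4 \<and> \<beta> 6 = 6"
    if "\<alpha> 0 = 0 \<and> \<alpha> 1 = 1 \<and> \<alpha> 2 = 3 \<and> \<alpha> 3 = 2"
    by (intro conjI \<beta>_eq) (simp_all add: ends ends_K4_plus that[unfolded One_nat_def] insert_commute)
  have case3: "\<beta> 2 = 4 \<and> \<beta> 3 = 5 \<and> \<beta> 4 = 2 \<and> \<beta> 5 = 3 \<and> \<beta> 6 = 6"
    if "\<alpha> 0 = 1 \<and> \<alpha> 1 = 0 \<and> \<alpha> 2 = 2 \<and> \<alpha> 3 = 3"
    by (intro conjI \<beta>_eq) (simp_all add: ends ends_K4_plus that[unfolded One_nat_def] insert_commute)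
  have case4: "\<beta> 2 = 5 \<and> \<beta> 3 = 4 \<and> \<beta> 4 = 3 \<and> \<beta> 5 = 2 \<and> \<beta> 6 = 6"
    if "\<alpha> 0 = 1 \<and> \<alpha> 1 = 0 \<and> \<alpha> 2 = 3 \<and> \<alpha> 3 = 2"
    by (intro conjI \<beta>_eq) (simp_all add: ends ends_K4_plus that[unfolded One_nat_def] insert_commute)
  let ?a = "[\<alpha> 0, \<alpha> 1, \<alpha> 2, \<alpha> 3]" and ?b = "[\<beta> 0, \<beta> 1, \<beta> 2, \<beta> 3, \<beta> 4, \<beta> 5, \<beta> 6]"
  \<comment> \<open>Four vertex maps times two ways to place edges 0 and 1 give the eight
    entries.\<close>
  have "(?a, ?b) \<in> set K4_plus_autos"
    using vs \<beta>01 case1 case2 case3 case4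
    by (elim disjE conjE insertE emptyE) (simp_all add: K4_plus_autos_def)
  moreover have "(\<forall>v \<in> verts K4_plus. \<alpha> v = ?a ! v) \<and> (\<forall>e \<in> edges K4_plus. \<beta> e = ?b ! e)"
    by (simp add: verts_K4_plus edges_K4_plus)
  ultimately show ?thesis
    by blast
qed


section \<open>The classification\<close>

text \<open>
  The method \<open>code_simp\<close> rewrites both arguments of a connective before the connective itself, but
  it leaves the branches of a conditional alone. Hence these equations, and the conditionals in
  the definitions to be evaluated.
\<close>

lemma list_all_if [code]:
  "list_all P [] \<longleftrightarrow> True"
  "list_all P (x # xs) \<longleftrightarrow> (if P x then list_all P xs else False)"
  by simp_all

lemma list_ex_if [code]:
  "list_ex P [] \<longleftrightarrow> False"
  "list_ex P (x # xs) \<longleftrightarrow> (if P x then True else list_ex P xs)"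
  by simp_all

section \<open>Comparing codes under the automorphisms\<close>

fun agree_at :: "nat list list \<Rightarrow> nat list list \<Rightarrow> nat list \<times> nat list \<Rightarrow> nat \<times> nat \<Rightarrow> bool" where
  "agree_at c c' (a, b) (v, e) \<longleftrightarrow> next_in (c' ! (a ! v)) (b ! e) = b ! next_in (c ! v) e"

definition agree :: "nat list list \<Rightarrow> nat list list \<Rightarrow> nat list \<times> nat list \<Rightarrow> bool" where
  "agree c c' g \<longleftrightarrow> list_all (agree_at c c' g) K4_plus_darts"

definition isomorphic_codes :: "nat list list \<Rightarrow> nat list list \<Rightarrow> bool" where
  "isomorphic_codes c c' \<longleftrightarrow> list_ex (agree c c') K4_plus_autos"

definition equivalent_codes :: "nat list list \<Rightarrow> nat list list \<Rightarrow> bool" where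
  "equivalent_codes c c' \<longleftrightarrow> (if isomorphic_codes c c' then True else isomorphic_codes (map rev c) c')"

lemma isomorphic_embeddings_rotations_iff:
  assumes "valid_code c" "valid_code c'"
  shows "isomorphic_embeddings K4_plus (rotations c) (rotations c') \<longleftrightarrow> isomorphic_codes c c'"
proof -
  \<comment> \<open>Stated for any \<alpha> and \<beta> matching the lists on the graph, so that it
    serves a given isomorphism in one direction and \<open>list_perm\<close> in the other.\<close>
  have agree_iff: "agree c c' (a, b) \<longleftrightarrow> (\<forall>v \<in> verts K4_plus. \<forall>e \<in> incident_edges K4_plus v.
      rotations c' (\<alpha> v) (\<beta> e) = \<beta> (rotations c v e))"
    if perm: "\<alpha> permutes verts K4_plus" "\<beta> permutes edges K4_plus"
      and ends: "\<And>e. e \<in> edges K4_plus \<Longrightarrow> ends K4_plus (\<beta> e) = \<alpha> ` ends K4_plus e"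
      and eq: "\<And>v. v \<in> verts K4_plus \<Longrightarrow> \<alpha> v = a ! v" "\<And>e. e \<in> edges K4_plus \<Longrightarrow> \<beta> e = b ! e"
    for \<alpha> \<beta> a b
  proof -
    have "agree_at c c' (a, b) (v, e) \<longleftrightarrow> rotations c' (\<alpha> v) (\<beta> e) = \<beta> (rotations c v e)"
      if v: "v \<in> verts K4_plus" and e: "e \<in> incident_edges K4_plus v" for v e
    proof -
      have "\<alpha> v \<in> verts K4_plus"
        using v permutes_in_image[OF perm(1)] by blast
      moreover have "\<beta> e \<in> incident_edges K4_plus (\<alpha> v)"
        using e ends permutes_in_image[OF perm(2)] by (auto simp: incident_edges_def)
      ultimately have "next_in (c' ! (a ! v)) (b ! e) = rotations c' (\<alpha> v) (\<beta> e)"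
        using next_in_valid_code(1)[OF assms(2)] eq v e by (simp add: incident_edges_def)
      moreover have "b ! next_in (c ! v) e = \<beta> (rotations c v e)"
        using next_in_valid_code[OF assms(1) v e] eq(2) by (simp add: incident_edges_def)
      ultimately show ?thesis
        by simp
    qed
    moreover have "agree c c' (a, b) \<longleftrightarrow> (\<forall>v \<in> verts K4_plus. \<forall>e \<in> incident_edges K4_plus v.
        agree_at c c' (a, b) (v, e))"
      unfolding agree_def list_all_iff darts_K4_plus[symmetric] darts_def by auto
    ultimately show ?thesis
      by simp
  qed
  show ?thesis
  proof
    assume "isomorphic_embeddings K4_plus (rotations c) (rotations c')"
    then obtain \<alpha> \<beta> where iso: "isomorphism K4_plus \<alpha> \<beta> (rotations c) (rotations c')"
      unfolding isomorphic_embeddings_iff_isomorphism by blast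
    obtain a b where ab: "(a, b) \<in> set K4_plus_autos"
      and eq: "\<And>v. v \<in> verts K4_plus \<Longrightarrow> \<alpha> v = a ! v" "\<And>e. e \<in> edges K4_plus \<Longrightarrow> \<beta> e = b ! e"
      using K4_plus_autos_complete[OF isomorphismD(1-3)[OF iso]] by auto
    have "agree c c' (a, b)"
      using agree_iff[OF isomorphismD(1-3)[OF iso] eq] isomorphismD(4)[OF iso] by simp
    with ab show "isomorphic_codes c c'"
      unfolding isomorphic_codes_def list_ex_iff by blast
  next
    assume "isomorphic_codes c c'"
    then obtain a b where ab: "(a, b) \<in> set K4_plus_autos" "agree c c' (a, b)"
      unfolding isomorphic_codes_def list_ex_iff by auto
    note auto = K4_plus_autos_sound[OF ab(1)]
    have "isomorphism K4_plus (list_perm a) (list_perm b) (rotations c) (rotations c')"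
      using agree_iff[OF auto] ab(2) auto(1-3) by (simp add: isomorphism_def)
    then show "isomorphic_embeddings K4_plus (rotations c) (rotations c')"
      unfolding isomorphic_embeddings_iff_isomorphism by blast
  qed
qed

lemma equivalent_embeddings_rotations_iff:
  assumes "valid_code c" "valid_code c'"
  shows "equivalent_embeddings K4_plus (rotations c) (rotations c') \<longleftrightarrow> equivalent_codes c c'"
  unfolding equivalent_embeddings_def equivalent_codes_def
    valid_code_rev(2)[OF assms(1), symmetric]
    isomorphic_embeddings_rotations_iff[OF assms]
    isomorphic_embeddings_rotations_iff[OF valid_code_rev(1)[OF assms(1)] assms(2)]
  by simp

lemma nonorientable_embedding_rotations_iff:
  assumes "valid_code c"
  shows "nonorientable_embedding K4_plus (rotations c) \<longleftrightarrow> isomorphic_codes (map rev c) c"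
  unfolding nonorientable_embedding_def valid_code_rev(2)[OF assms, symmetric]
  by (rule isomorphic_embeddings_rotations_iff[OF valid_code_rev(1)[OF assms] assms])

text \<open>The parallel edges are consecutive at vertex 0 and opposite at vertex 1. The two codes
  differ only by the orientation at vertex 3.\<close>

definition chiral_codes :: "nat list list list" where
  "chiral_codes =
    [[[0, 1, 2, 3], [0, 4, 1, 5], [2, 6, 4], [3, 5, 6]],
     [[0, 1, 2, 3], [0, 4, 1, 5], [2, 6, 4], [3, 6, 5]]]"

text \<open>The parallel edges are consecutive at both ends in the first two codes and opposite at
  both in the third. The automorphism from the reversal also exchanges vertices 2 and 3 for the
  first code and fixes them for the others.\<close>

definition achiral_codes :: "nat list list list" where
  "achiral_codes =
    [[[0, 1, 2, 3], [0, 1, 4, 5], [2, 4, 6], [3, 5, 6]],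
     [[0, 1, 2, 3], [0, 1, 5, 4], [2, 4, 6], [3, 5, 6]],
     [[0, 2, 1, 3], [0, 4, 1, 5], [2, 4, 6], [3, 6, 5]]]"

definition classified :: "nat list list \<Rightarrow> bool" where
  "classified c \<longleftrightarrow>
    (if one_face c then list_ex (equivalent_codes c) (chiral_codes @ achiral_codes) else True)"

definition isolated :: "nat list list \<Rightarrow> bool" where
  "isolated c \<longleftrightarrow> filter (equivalent_codes c) (chiral_codes @ achiral_codes) = [c]"

definition achiral :: "nat list list \<Rightarrow> bool" where
  "achiral c \<longleftrightarrow> isomorphic_codes (map rev c) c"

text \<open>The exhaustive check: codes with several faces are dismissed by an early return, and
  only the others are searched for an equivalent representative.\<close>

lemma all_classified: "list_all classified K4_plus_codes"
  by code_simp

lemma representatives_isolated: "list_all isolated (chiral_codes @ achiral_codes)"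
  by code_simp

lemma representatives_one_face: "list_all one_face (chiral_codes @ achiral_codes)"
  by code_simp

lemma representatives_codes: "set (chiral_codes @ achiral_codes) \<subseteq> set K4_plus_codes"
  by code_simp

lemma filter_achiral:
  "filter achiral chiral_codes = []" "filter achiral achiral_codes = achiral_codes"
  by code_simp+

theorem theorem14:
  shows "card ({\<pi> \<in> embeddings K4_plus 2. orientable_embedding K4_plus \<pi>}
            // embedding_equiv K4_plus 2) = 2 \<and>
         card ({\<pi> \<in> embeddings K4_plus 2. nonorientable_embedding K4_plus \<pi>}
            // embedding_equiv K4_plus 2) = 3"
proof -
  let ?E = "embeddings K4_plus 2" and ?R = "embedding_equiv K4_plus 2"
  let ?reps = "set (chiral_codes @ achiral_codes)"
  have code: "c \<in> set K4_plus_codes" "valid_code c" "rotations c \<in> ?E" if "c \<in> ?reps" for c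
    using that representatives_codes representatives_one_face rotations_in_embeddings_iff
      valid_code_K4_plus_codes by (auto simp only: list_all_iff)
  have rep: "\<exists>c \<in> ?reps. (\<pi>, rotations c) \<in> ?R" if "\<pi> \<in> ?E" for \<pi>
  proof -
    have "rotation_system K4_plus \<pi>"
      using that by (simp add: embeddings_def)
    then obtain c where c: "c \<in> set K4_plus_codes" "\<pi> = rotations c"
      using rotation_system_K4_plus_iff by blast
    then have "one_face c"
      using that rotations_in_embeddings_iff by blast
    moreover have "classified c"
      using all_classified c(1) by (simp add: list_all_iff)
    ultimately have "\<exists>r \<in> ?reps. equivalent_codes c r"
      by (simp add: classified_def list_ex_iff)
    then obtain r where r: "r \<in> ?reps" "equivalent_codes c r"
      by blast
    then have "equivalent_embeddings K4_plus \<pi> (rotations r)"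
      using equivalent_embeddings_rotations_iff valid_code_K4_plus_codes c code(2) by blast
    with r(1) that code(3) show ?thesis
      unfolding embedding_equiv_def by blast
  qed
  have eq: "r = s" if "r \<in> ?reps" "s \<in> ?reps" "(rotations r, rotations s) \<in> ?R" for r s
  proof -
    have "equivalent_codes r s"
      using that equivalent_embeddings_rotations_iff code(2) by (auto simp: embedding_equiv_def)
    then have "s \<in> set (filter (equivalent_codes r) (chiral_codes @ achiral_codes))"
      using that(2) by simp
    also have "\<dots> = {r}"
      using representatives_isolated that(1) by (simp add: list_all_iff isolated_def)
    finally show ?thesis
      by simp
  qed
  have equiv: "equiv ?E ?R"
    by (rule equiv_embedding_equiv)
  \<comment> \<open>Equal rotation systems are equivalent by reflexivity, so \<open>eq\<close>
    applies; this allows counting codes instead of functions.\<close>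
  have inj: "inj_on rotations ?reps"
    using eq code(3) equiv_class_self[OF equiv] by (intro inj_onI) (metis Image_singleton_iff)
  have nonorientable: "nonorientable_embedding K4_plus (rotations c) \<longleftrightarrow> c \<in> set achiral_codes"
    if "c \<in> ?reps" for c
    using that nonorientable_embedding_rotations_iff[OF code(2)[OF that]] filter_achiral
    by (auto simp: achiral_def filter_empty_conv filter_id_conv)
  \<comment> \<open>An invariant property holds for all or none of a class, so its classes are
    counted by the representatives that have it.\<close>
  have classes: "card ({\<pi> \<in> ?E. P \<pi>} // ?R) = card cs"
    if invariant: "\<And>\<pi> \<pi>'. (\<pi>, \<pi>') \<in> ?R \<Longrightarrow> P \<pi> \<Longrightarrow> P \<pi>'"
      and cs: "cs = {c \<in> ?reps. P (rotations c)}" for P cs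
  proof -
    have "card ({\<pi> \<in> ?E. P \<pi>} // ?R) = card (rotations ` cs)"
    proof (rule card_quotient_representatives[OF equiv])
      show "rotations ` cs \<subseteq> {\<pi> \<in> ?E. P \<pi>}"
        using code(3) cs by blast
      show "\<exists>r \<in> rotations ` cs. (r, \<pi>) \<in> ?R" if "\<pi> \<in> {\<pi> \<in> ?E. P \<pi>}" for \<pi>
        using that rep[of \<pi>] invariant cs equiv by (auto elim!: equivE dest: symD)
      show "r = s" if "r \<in> rotations ` cs" "s \<in> rotations ` cs" "(r, s) \<in> ?R" for r s
        using that eq cs by blast
    qed blast
    also have "\<dots> = card cs"
      using inj cs by (intro card_image) (auto intro: inj_on_subset)
    finally show ?thesis .
  qed
  \<comment> \<open>Orientability is a negation, so its invariance uses the relation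
    backwards.\<close>
  have sym: "(\<pi>', \<pi>) \<in> ?R" if "(\<pi>, \<pi>') \<in> ?R" for \<pi> \<pi>'
    using that equiv by (auto elim: equivE dest: symD)
  have "card ({\<pi> \<in> ?E. orientable_embedding K4_plus \<pi>} // ?R) = card (set chiral_codes)"
  proof (rule classes)
    show "orientable_embedding K4_plus \<pi>'"
      if "(\<pi>, \<pi>') \<in> ?R" "orientable_embedding K4_plus \<pi>" for \<pi> \<pi>'
      using that nonorientable_embedding_equiv[OF sym] by (auto simp: orientable_embedding_def)
    have "set chiral_codes \<inter> set achiral_codes = {}"
      by (simp add: chiral_codes_def achiral_codes_def)
    then show "set chiral_codes = {c \<in> ?reps. orientable_embedding K4_plus (rotations c)}"
      using nonorientable by (auto simp: orientable_embedding_def)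
  qed
  moreover have "card ({\<pi> \<in> ?E. nonorientable_embedding K4_plus \<pi>} // ?R) = card (set achiral_codes)"
  proof (rule classes)
    show "nonorientable_embedding K4_plus \<pi>'"
      if "(\<pi>, \<pi>') \<in> ?R" "nonorientable_embedding K4_plus \<pi>" for \<pi> \<pi>'
      using that by (rule nonorientable_embedding_equiv)
    show "set achiral_codes = {c \<in> ?reps. nonorientable_embedding K4_plus (rotations c)}"
      using nonorientable by auto
  qed
  ultimately show ?thesis
    by (simp add: chiral_codes_def achiral_codes_def)
qed

end
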